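(* For every ecumenical formula of the form $A^c$ (with $A^i$ its intuitionistic counterpart) and every atomic system $S$, $\Vdash^L_S (A^c\vee\neg A^i)^i$.
   Context: Basic setting. Let $\mathsf{At}$ be a countably infinite set of atomic propositions and $\mathsf{At}_\bot=\mathsf{At}\cup\{\bot\}$. An atomic rule has the form "from premises $p_1,\dots,p_n$ ($n\ge 0$) infer $p$", with $p_j,p\in\mathsf{At}_\bot$, where the derivation of each premise may discharge a set of basic sentences. An atomic system $S$ is a set of atomic rules; $S\subseteq S'$ ($S'$ extends $S$) if $S'$ contains all rules of $S$. $\Delta\vdash_S p$ means there is a natural-deduction derivation using only rules of $S$ with conclusion $p$ and undischarged assumptions in $\Delta$ (so $p\vdash_S p$). $S$ is consistent if $\nvdash_S\bot$. Standing convention: all atomic systems (including all extensions quantified over) are required to be consistent. Ecumenical formulas: $p^i,p^c$ for $p\in\mathsf{At}_\bot$; $(A\wedge B)^x,(A\vee B)^x,(A\to B)^x$ for $x\in\{i,c\}$. $\bot$ denotes $\bot^i$, $\neg A:=(A\to\bot^i)^i$; for $X^c$, $X^i$ is the same construction with outer superscript $i$. Weak validity (by simultaneous recursion): (1) $\Vdash^L_S p^i$ iff $\vdash_S p$ ($p\in\mathsf{At}_\bot$); (2) $\Vdash^L_S p^c$ iff $p\nvdash_S\bot$; (3) for non-atomic $X$, $\Vdash^L_S X^c$ iff $X^i\nVdash^L_S\bot$; (4) $\Vdash^L_S(A\wedge B)^i$ iff $\Vdash^L_S A$ and $\Vdash^L_S B$; (5) $\Vdash^L_S(A\to B)^i$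 iff $A\Vdash^G_S B$; (6) $\Vdash^L_S(A\vee B)^i$ iff for all $S'\supseteq S$ and all $p\in\mathsf{At}_\bot$, if $A\Vdash^L_{S'}p^i$ and $B\Vdash^L_{S'}p^i$ then $\Vdash^L_{S'}p^i$; (7) for nonempty $\Gamma$, $\Gamma\Vdash^L_S A$ iff for all $S'\supseteq S$, if $\Vdash^L_{S'}B$ for all $B\in\Gamma$ then $\Vdash^L_{S'}A$; (8) $\Gamma\Vdash^G_S A$ iff for all $S'\supseteq S$: if $\Vdash^L_{S''}B$ for all $B\in\Gamma$ and all $S''\supseteq S'$, then $\Vdash^L_{S''}A$ for all $S''\supseteq S'$. *)

theory Defs
  imports "HOL-Library.Countable_Set"
begin

datatype 'at basic = Atom 'at | Bot

text \<open>
  A rule lists its premises, each paired with the set of basic sentences that the derivation of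
  that premise may discharge.
\<close>

datatype 'at rule = Rule (prems: "('at basic set \<times> 'at basic) list") (concl: "'at basic")

type_synonym 'at system = "'at rule set"

text \<open>
  Natural deduction with explicit contexts: the context contains the assumptions that are still
  available, so the assumptions a rule discharges are added when passing to its premises.
\<close>

inductive derives :: "'at system \<Rightarrow> 'at basic set \<Rightarrow> 'at basic \<Rightarrow> bool" for S where
  assumption: "p \<in> \<Delta> \<Longrightarrow> derives S \<Delta> p"
| apply_rule: "r \<in> S \<Longrightarrow> (\<And>D q. (D, q) \<in> set (prems r) \<Longrightarrow> derives S (\<Delta> \<union> D) q)
    \<Longrightarrow> derives S \<Delta> (concl r)"

definition consistent :: "'at system \<Rightarrow> bool" where
  "consistent S \<longleftrightarrow> \<not> derives S {} Bot"

text \<open>Only consistent extensions are ever quantified over.\<close>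

definition extends :: "'at system \<Rightarrow> 'at system \<Rightarrow> bool" where
  "extends S' S \<longleftrightarrow> S \<subseteq> S' \<and> consistent S'"

datatype mark = Intu | Clas

text \<open>
  A formula is a construct carrying an outer superscript, so for a construct \<open>X\<close> the formulas
  written $X^i$ and $X^c$ are \<open>Mark X Intu\<close> and \<open>Mark X Clas\<close>.
\<close>

datatype 'at construct =
    Basic "'at basic"
  | Conj "'at formula" "'at formula"
  | Disj "'at formula" "'at formula"
  | Impl "'at formula" "'at formula"
and 'at formula = Mark "'at construct" mark

abbreviation Falsum :: "'at formula" where
  "Falsum \<equiv> Mark (Basic Bot) Intu"

abbreviation Neg :: "'at formula \<Rightarrow> 'at formula" where
  "Neg A \<equiv> Mark (Impl A Falsum) Intu"

text \<open>
  The two consequence relations are parametrised by a validity predicate \<open>V\<close> so that the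
  simultaneous recursion can be written as a single function. With no hypotheses, the local
  relation is validity in \<open>S\<close> itself, not validity in all its extensions; weak validity is not
  monotone, so this matters.
\<close>

definition local_cons ::
  "('at system \<Rightarrow> 'at formula \<Rightarrow> bool) \<Rightarrow> 'at system \<Rightarrow> 'at formula set \<Rightarrow> 'at formula \<Rightarrow> bool" where
  "local_cons V S \<Gamma> A \<longleftrightarrow>
     (if \<Gamma> = {} then V S A
      else \<forall>S'. extends S' S \<longrightarrow> (\<forall>B\<in>\<Gamma>. V S' B) \<longrightarrow> V S' A)"

definition global_cons ::
  "('at system \<Rightarrow> 'at formula \<Rightarrow> bool) \<Rightarrow> 'at system \<Rightarrow> 'at formula set \<Rightarrow> 'at formula \<Rightarrow> bool" where
  "global_cons V S \<Gamma> A \<longleftrightarrow>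
     (\<forall>S'. extends S' S \<longrightarrow>
        (\<forall>B\<in>\<Gamma>. \<forall>S''. extends S'' S' \<longrightarrow> V S'' B) \<longrightarrow>
        (\<forall>S''. extends S'' S' \<longrightarrow> V S'' A))"

lemma local_cons_cong [fundef_cong]:
  assumes "S = S'" "\<Gamma> = \<Gamma>'" "A = A'"
    and "\<And>T B. B \<in> insert A' \<Gamma>' \<Longrightarrow> V T B = V' T B"
  shows "local_cons V S \<Gamma> A = local_cons V' S' \<Gamma>' A'"
  using assms unfolding local_cons_def by simp

lemma global_cons_cong [fundef_cong]:
  assumes "S = S'" "\<Gamma> = \<Gamma>'" "A = A'"
    and "\<And>T B. B \<in> insert A' \<Gamma>' \<Longrightarrow> V T B = V' T B"
  shows "global_cons V S \<Gamma> A = global_cons V' S' \<Gamma>' A'"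
  using assms unfolding global_cons_def by simp

primrec construct_rank :: "'at construct \<Rightarrow> nat" and formula_rank :: "'at formula \<Rightarrow> nat" where
  "construct_rank (Basic p) = 0"
| "construct_rank (Conj A B) = Suc (formula_rank A + formula_rank B)"
| "construct_rank (Disj A B) = Suc (formula_rank A + formula_rank B)"
| "construct_rank (Impl A B) = Suc (formula_rank A + formula_rank B)"
| "formula_rank (Mark X m) = 2 * construct_rank X + (if m = Clas then 1 else 0)"

function weakly_valid :: "'at system \<Rightarrow> 'at formula \<Rightarrow> bool" where
  "weakly_valid S (Mark (Basic p) Intu) \<longleftrightarrow> derives S {} p"
| "weakly_valid S (Mark (Basic p) Clas) \<longleftrightarrow> \<not> derives S {p} Bot"
| "weakly_valid S (Mark (Conj A B) Clas) \<longleftrightarrow>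
     \<not> local_cons weakly_valid S {Mark (Conj A B) Intu} Falsum"
| "weakly_valid S (Mark (Disj A B) Clas) \<longleftrightarrow>
     \<not> local_cons weakly_valid S {Mark (Disj A B) Intu} Falsum"
| "weakly_valid S (Mark (Impl A B) Clas) \<longleftrightarrow>
     \<not> local_cons weakly_valid S {Mark (Impl A B) Intu} Falsum"
| "weakly_valid S (Mark (Conj A B) Intu) \<longleftrightarrow> weakly_valid S A \<and> weakly_valid S B"
| "weakly_valid S (Mark (Impl A B) Intu) \<longleftrightarrow> global_cons weakly_valid S {A} B"
| "weakly_valid S (Mark (Disj A B) Intu) \<longleftrightarrow>
     (\<forall>S' p. extends S' S \<longrightarrow>
        local_cons weakly_valid S' {A} (Mark (Basic p) Intu) \<longrightarrow>
        local_cons weakly_valid S' {B} (Mark (Basic p) Intu) \<longrightarrow>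
        weakly_valid S' (Mark (Basic p) Intu))"
  by pat_completeness auto
termination
  by (relation "measure (\<lambda>(S, A). formula_rank A)") auto

end

theory Submission
  imports Defs
begin

text \<open>
  Let $S'$ be an extension in which the disjunction is tested. Either $A^c$ is weakly valid in $S'$,
  or no consistent extension of $S'$ validates $A^i$; in the latter case $\neg A^i$ holds vacuously.
  Hence one of the two minor premises can be applied at $S'$ itself. For atomic $A$, the
  failure of $A^c$ is a derivation of $\bot$ from $A$, which a cut turns into an inconsistency of
  any extension deriving $A$.
\<close>

lemma derives_mono:
  assumes "derives S \<Delta> p" "S \<subseteq> S'" "\<Delta> \<subseteq> \<Delta>'"
  shows "derives S' \<Delta>' p"
  using assms
proof (induction arbitrary: \<Delta>' rule: derives.induct)
  case (assumption p \<Delta>)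
  then show ?case by (blast intro: derives.assumption)
next
  case (apply_rule r \<Delta>)
  have "derives S' (\<Delta>' \<union> D) q" if "(D, q) \<in> set (prems r)" for D q
    using apply_rule.IH[OF that, of "\<Delta>' \<union> D"] apply_rule.prems by blast
  then show ?case
    using apply_rule.hyps apply_rule.prems by (blast intro: derives.apply_rule)
qed

text \<open>Derivations are grafted onto the open assumptions. \<open>\<Delta>'\<close> stays
  general in the induction because each premise enlarges the context by what it discharges.\<close>

lemma derives_cut:
  assumes "derives S \<Delta> q" "\<And>p. p \<in> \<Delta> \<Longrightarrow> derives S \<Delta>' p"
  shows "derives S \<Delta>' q"
  using assms
proof (induction arbitrary: \<Delta>' rule: derives.induct)
  case (assumption p \<Delta>)
  then show ?case by blast
next
  case (apply_rule r \<Delta>)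
  have "derives S (\<Delta>' \<union> D) q" if "(D, q) \<in> set (prems r)" for D q
  proof (rule apply_rule.IH[OF that])
    fix p assume "p \<in> \<Delta> \<union> D"
    then show "derives S (\<Delta>' \<union> D) p"
      using apply_rule.prems by (blast intro: derives.assumption derives_mono)
  qed
  then show ?case
    using apply_rule.hyps by (blast intro: derives.apply_rule)
qed

text \<open>Only a consistent system extends itself; the premise supplies that consistency.\<close>

lemma extends_refl: "extends T S \<Longrightarrow> extends T T"
  by (simp add: extends_def)

lemma local_cons_singleton:
  "local_cons V S {B} A \<longleftrightarrow> (\<forall>T. extends T S \<longrightarrow> V T B \<longrightarrow> V T A)"
  by (simp add: local_cons_def)

lemma not_valid_Falsum: "extends T S \<Longrightarrow> \<not> weakly_valid T Falsum"
  by (simp add: extends_def consistent_def)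

lemma not_valid_Intu_if_not_valid_Clas:
  assumes "\<not> weakly_valid S (Mark X Clas)" "extends T S"
  shows "\<not> weakly_valid T (Mark X Intu)"
proof (cases X)
  case (Basic q)
  have "derives T {q} Bot"
    using assms Basic by (auto simp: extends_def intro: derives_mono)
  then have "\<not> derives T {} q"
    using assms(2) derives_cut[of T "{q}" Bot "{}"] by (auto simp: extends_def consistent_def)
  then show ?thesis
    using Basic by simp
\<comment> \<open>For compound \<open>X\<close>, failure of the classical form says that an
  extension validating the intuitionistic form validates \<open>Falsum\<close>, which consistency
  forbids.\<close>
qed (use assms not_valid_Falsum in
    \<open>simp_all only: weakly_valid.simps(3-5) local_cons_singleton, blast+\<close>)

lemma valid_Neg_Intu_if_not_valid_Clas:
  assumes "\<not> weakly_valid S (Mark X Clas)"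
  shows "weakly_valid S (Neg (Mark X Intu))"
  \<comment> \<open>The global hypothesis ranges over all extensions of a system, including that
    system itself, where it already fails.\<close>
  using not_valid_Intu_if_not_valid_Clas[OF assms] extends_refl
  by (auto simp: global_cons_def)

theorem theorem8:
  fixes X :: "'at construct" and S :: "'at system"
  assumes "countable (UNIV :: 'at set)" and "infinite (UNIV :: 'at set)"
    and "consistent S"
  shows "weakly_valid S (Mark (Disj (Mark X Clas) (Neg (Mark X Intu))) Intu)"
proof -
  have "weakly_valid S' (Mark (Basic p) Intu)"
    if "extends S' S"
      and "local_cons weakly_valid S' {Mark X Clas} (Mark (Basic p) Intu)"
      and "local_cons weakly_valid S' {Neg (Mark X Intu)} (Mark (Basic p) Intu)"
    for S' p
    using that extends_refl[OF that(1)] valid_Neg_Intu_if_not_valid_Clas[of S' X]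
    unfolding local_cons_singleton by blast
  then show ?thesis
    by (simp only: weakly_valid.simps) blast
qed

end
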